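(* If $T$ is a finite tree on at least three vertices with $\ell$ leaves, then $B(T) = \ell$.
   Context: Bodyguards and Presidents is a two-player game on a finite simple graph $G$. One player controls a set of tokens called bodyguards, the other a single token called the president. First all bodyguards are placed on vertices (several may share a vertex), then the president is placed. The players then alternate turns, bodyguards first; on a player's turn, each token they control either moves to an adjacent vertex or stays put. The president is surrounded if every vertex of the open neighbourhood of the president's vertex is occupied by a bodyguard. The bodyguards win if there is a finite time after which, at the end of every bodyguard turn, the president is surrounded; otherwise the president wins. The bodyguard number $B(G)$ is the minimum number of bodyguards that guarantees a win for the bodyguards on $G$. *)

theory Defs
  imports "Graph_Theory.Digraph_Component"
begin

text \<open>
  A finite simple graph is a \<^locale>\<open>pair_graph\<close>: each edge is represented by the two
  opposite arcs between its endpoints.  In this representation going back and forth along a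
  single edge is a \<^const>\<open>pre_digraph.cycle\<close> of length 2, so the library's \<open>tree\<close> is of no use for
  undirected graphs; cycles of an undirected graph are those of length at least 3.
\<close>

definition undirected_tree :: "'a pair_pre_digraph \<Rightarrow> bool" where
  "undirected_tree G \<longleftrightarrow>
     pair_graph G \<and> connected (with_proj G) \<and>
     \<not> (\<exists>c. pre_digraph.cycle (with_proj G) c \<and> 3 \<le> length c)"

definition open_neighbourhood :: "'a pair_pre_digraph \<Rightarrow> 'a \<Rightarrow> 'a set" where
  "open_neighbourhood G v = {w. (v, w) \<in> parcs G}"

definition leaves :: "'a pair_pre_digraph \<Rightarrow> 'a set" where
  "leaves G = {v \<in> pverts G. card (open_neighbourhood G v) = 1}"

definition token_move :: "'a pair_pre_digraph \<Rightarrow> 'a \<Rightarrow> 'a \<Rightarrow> bool" where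
  "token_move G u v \<longleftrightarrow> v = u \<or> v \<in> open_neighbourhood G u"

text \<open>\<open>p 0\<close> is the president's initial vertex and \<open>p n\<close> the vertex after \<open>n\<close> president turns.\<close>

definition president_play :: "'a pair_pre_digraph \<Rightarrow> (nat \<Rightarrow> 'a) \<Rightarrow> bool" where
  "president_play G p \<longleftrightarrow> p 0 \<in> pverts G \<and> (\<forall>n. token_move G (p n) (p (Suc n)))"

text \<open>
  A strategy maps the list of president positions seen so far to the positions of the
  bodyguards, numbered \<open>0, \<dots>, k - 1\<close>.  The empty list gives the initial placement, made before
  the president is placed; earlier bodyguard positions are determined by the strategy itself.
\<close>

type_synonym 'a bodyguard_strategy = "'a list \<Rightarrow> nat \<Rightarrow> 'a"

text \<open>The bodyguard positions after \<open>n\<close> bodyguard turns; turn \<open>Suc n\<close> is the response to \<open>p n\<close>.\<close>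

definition bodyguards_at :: "'a bodyguard_strategy \<Rightarrow> (nat \<Rightarrow> 'a) \<Rightarrow> nat \<Rightarrow> nat \<Rightarrow> 'a" where
  "bodyguards_at S p n = S (map p [0..<n])"

definition legal_strategy :: "'a pair_pre_digraph \<Rightarrow> nat \<Rightarrow> 'a bodyguard_strategy \<Rightarrow> bool" where
  "legal_strategy G k S \<longleftrightarrow>
     (\<forall>i<k. S [] i \<in> pverts G) \<and>
     (\<forall>p. president_play G p \<longrightarrow>
        (\<forall>n. \<forall>i<k. token_move G (bodyguards_at S p n i) (bodyguards_at S p (Suc n) i)))"

definition surrounded :: "'a pair_pre_digraph \<Rightarrow> nat \<Rightarrow> (nat \<Rightarrow> 'a) \<Rightarrow> 'a \<Rightarrow> bool" where
  "surrounded G k b v \<longleftrightarrow> open_neighbourhood G v \<subseteq> b ` {..<k}"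

definition bodyguards_win :: "'a pair_pre_digraph \<Rightarrow> nat \<Rightarrow> bool" where
  "bodyguards_win G k \<longleftrightarrow>
     (\<exists>S. legal_strategy G k S \<and>
        (\<forall>p. president_play G p \<longrightarrow>
           (\<exists>N. \<forall>n\<ge>N. surrounded G k (bodyguards_at S p (Suc n)) (p n))))"

definition bodyguard_number :: "'a pair_pre_digraph \<Rightarrow> nat" where
  "bodyguard_number G = (LEAST k. bodyguards_win G k)"

text \<open>The minimum exists: one stationary bodyguard per vertex suffices.\<close>

lemma bodyguards_win_card_verts:
  assumes "pair_graph G"
  shows "bodyguards_win G (card (pverts G))"
proof -
  interpret pair_graph G by (fact assms)
  obtain f :: "nat \<Rightarrow> 'a" where f: "bij_betw f {0..<card (pverts G)} (pverts G)"
    using ex_bij_betw_nat_finite[OF pair_finite_verts] by blast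
  have img: "f ` {..<card (pverts G)} = pverts G"
    using f by (simp add: bij_betw_def lessThan_atLeast0)
  have "legal_strategy G (card (pverts G)) (\<lambda>_. f)"
    using img by (auto simp: legal_strategy_def bodyguards_at_def token_move_def)
  moreover have "surrounded G (card (pverts G)) f v" for v
    using img by (auto simp: surrounded_def open_neighbourhood_def dest: in_arcsD2)
  ultimately show ?thesis
    unfolding bodyguards_win_def by (intro exI[of _ "\<lambda>_. f"]) (simp add: bodyguards_at_def)
qed

end

theory Submission
  imports Defs
begin

text \<open>
  Upper bound: assign a bodyguard to every leaf \<open>x\<close> and let it stand on the path from the president
  to \<open>x\<close>, starting at \<open>x\<close>.  It can keep its distance when the president retreats from \<open>x\<close> and
  comes closer otherwise; since the tree is finite, it is finally adjacent to the president forever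
  (or on \<open>x\<close> together with him).  Every branch at the president's vertex contains a leaf, so he is
  then surrounded.

  Lower bound: against a winning strategy there is a history after which the president is surrounded
  whatever he does.  From then on every branch at his vertex holds at least as many
  bodyguards as leaves, by induction on the branch: when he steps into it, the bodyguards needed in
  the smaller branches ahead of him must already have been inside.
\<close>

section \<open>Branches of a tree at a vertex\<close>

text \<open>For an arc \<open>(v, u)\<close> this is the vertex set of the component containing
  \<open>u\<close> after deletion of \<open>v\<close>.\<close>

definition branch :: "'a pair_pre_digraph \<Rightarrow> 'a \<Rightarrow> 'a \<Rightarrow> 'a set" where
  "branch G v u = {w. (u, w) \<in> (Restr (parcs G) (- {v}))\<^sup>*}"

lemma branch_refl: "u \<in> branch G v u"
  by (simp add: branch_def)

lemma branch_step:
  assumes "w \<in> branch G v u" "(w, z) \<in> parcs G" "z \<noteq> v" "u \<noteq> v"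
  shows "z \<in> branch G v u"
proof -
  have "w \<noteq> v"
    using assms(1,4) unfolding branch_def by (auto elim: rtranclE)
  with assms show ?thesis
    unfolding branch_def by (auto intro: rtrancl_into_rtrancl)
qed

lemma branch_induct [consumes 1, case_names base step]:
  assumes "w \<in> branch G v u" "P u"
    and "\<And>y z. \<lbrakk>y \<in> branch G v u; (y, z) \<in> parcs G; z \<noteq> v; P y\<rbrakk> \<Longrightarrow> P z"
  shows "P w"
proof -
  have "(u, w) \<in> (Restr (parcs G) (- {v}))\<^sup>*" using assms(1) by (simp add: branch_def)
  then show ?thesis
    by (induction rule: rtrancl_induct) (use assms(2,3) in \<open>auto simp: branch_def\<close>)
qed

locale undirected_tree_graph = pair_graph G for G :: "'a pair_pre_digraph" +
  assumes tree: "undirected_tree G"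
begin

lemma arc_sym: "(u, v) \<in> parcs G \<Longrightarrow> (v, u) \<in> parcs G"
  using pair_sym_arcs by (auto simp: symmetric_def elim: symE)

lemma arc_irrefl: "(u, v) \<in> parcs G \<Longrightarrow> u \<noteq> v"
  using pair_no_loops by fastforce

lemma finite_neighbourhood: "finite (open_neighbourhood G v)"
  by (rule finite_subset[OF _ pair_finite_verts])
    (auto simp: open_neighbourhood_def dest: in_arcsD2)

lemma leaf_neighbourhood:
  assumes "v \<in> leaves G" "(v, u) \<in> parcs G"
  shows "open_neighbourhood G v = {u}"
proof -
  obtain w where "open_neighbourhood G v = {w}"
    using assms(1) by (auto simp: leaves_def card_1_singleton_iff)
  moreover have "u \<in> open_neighbourhood G v"
    using assms(2) by (simp add: open_neighbourhood_def)
  ultimately show ?thesis by simp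
qed

lemma not_in_own_branch:
  assumes "(v, u) \<in> parcs G"
  shows "v \<notin> branch G v u"
proof -
  have "w \<noteq> v" if "w \<in> branch G v u" for w
    using that by (induction rule: branch_induct) (use arc_irrefl[OF assms] in auto)
  then show ?thesis by blast
qed

lemma branch_subset_verts:
  assumes "(v, u) \<in> parcs G"
  shows "branch G v u \<subseteq> pverts G"
proof
  fix w assume "w \<in> branch G v u"
  then show "w \<in> pverts G"
    by (induction rule: branch_induct) (use in_arcsD2 assms in auto)
qed

lemma finite_branch: "(v, u) \<in> parcs G \<Longrightarrow> finite (branch G v u)"
  using branch_subset_verts pair_finite_verts finite_subset by blast

lemma branch_sym:
  assumes "w \<in> branch G v u" "u \<noteq> v"
  shows "u \<in> branch G v w"
proof -
  have "sym (Restr (parcs G) (- {v}))"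
    by (rule symI) (auto intro: arc_sym)
  then have "sym ((Restr (parcs G) (- {v}))\<^sup>*)" by (rule sym_rtrancl)
  then show ?thesis using assms by (auto simp: branch_def elim: symE)
qed

text \<open>The walk read off from the closure may repeat vertices. \<open>awalk_to_apath\<close>
  shortens it using only its own arcs, so the result still avoids \<open>v\<close> and can be closed
  up to a cycle through \<open>v\<close>.\<close>

lemma branch_apath:
  assumes "w \<in> branch G v u" "(v, u) \<in> parcs G"
  obtains p where "apath u p w" "v \<notin> set (pawalk_verts u p)"
proof -
  from assms have "\<exists>p. awalk u p w \<and> v \<notin> fst ` set p \<union> snd ` set p"
  proof (induction rule: branch_induct)
    case base
    then show ?case using in_arcsD2
      by (intro exI[of _ "[]"]) (auto simp: awalk_Nil_iff)
  next
    case (step y z)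
    then obtain p where p: "awalk u p y" "v \<notin> fst ` set p \<union> snd ` set p" by blast
    have "awalk y [(y, z)] z" using arc_implies_awalk[OF step(2)] by simp
    then have "awalk u (p @ [(y, z)]) z" using awalk_appendI[OF p(1)] by blast
    moreover have "y \<noteq> v" using step(1) not_in_own_branch[OF assms(2)] by blast
    ultimately show ?case using p(2) step(3) by (intro exI[of _ "p @ [(y, z)]"]) auto
  qed
  then obtain p where p: "awalk u p w" "v \<notin> fst ` set p \<union> snd ` set p" by blast
  let ?q = "awalk_to_apath p"
  have q: "apath u ?q w" using apath_awalk_to_apath[OF p(1)] .
  have "set (pawalk_verts u ?q) = {u} \<union> fst ` set ?q \<union> snd ` set ?q"
    using set_awalk_verts[OF awalkI_apath[OF q]] by simp
  then have "v \<notin> set (pawalk_verts u ?q)"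
    using awalk_to_apath_subset[OF p(1)] p(2) arc_irrefl[OF assms(2)] by auto
  with q show ?thesis by (rule that)
qed

text \<open>Acyclicity enters here: a path from \<open>u\<close> to a different \<open>w\<close>
  that avoids \<open>v\<close>, closed up through \<open>v\<close>, would be a cycle with at least
  three arcs.\<close>

lemma branch_neighbour_unique:
  assumes "(v, u) \<in> parcs G" "w \<in> branch G v u" "(v, w) \<in> parcs G"
  shows "w = u"
proof (rule ccontr)
  assume "w \<noteq> u"
  obtain p where p: "apath u p w" "v \<notin> set (pawalk_verts u p)"
    using branch_apath[OF assms(2,1)] .
  have "p \<noteq> []" using p(1) \<open>w \<noteq> u\<close> by (auto simp: apath_Nil_iff)
  have uw: "awalk u p w" "distinct (pawalk_verts u p)" using p(1) by (auto simp: apath_def)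
  have wv: "awalk w [(w, v)] v" using arc_implies_awalk[OF arc_sym[OF assms(3)]] by simp
  let ?c = "(v, u) # p @ [(w, v)]"
  have q: "awalk u (p @ [(w, v)]) v" using awalk_appendI[OF uw(1) wv] .
  have c: "awalk v ?c v" using q assms(1) by (simp add: awalk_Cons_iff del: awalk_append_iff)
  have "pawalk_verts u (p @ [(w, v)]) = pawalk_verts u p @ [v]"
    using awalk_verts_append[OF q] by simp
  then have "distinct (tl (pawalk_verts v ?c))"
    using uw(2) p(2) by simp
  then have "cycle ?c" using c unfolding cycle_def by blast
  moreover have "3 \<le> length ?c" using \<open>p \<noteq> []\<close> by (cases p) auto
  ultimately show False using tree unfolding undirected_tree_def by blast
qed

text \<open>A walk from \<open>w\<close> avoiding \<open>u\<close> cannot reach \<open>v\<close>,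
  which would be a second neighbour of \<open>u\<close> in the branch of \<open>w\<close>.
  Strictness, witnessed by \<open>u\<close>, drives the inductions on branch size.\<close>

lemma sub_branch:
  assumes "(v, u) \<in> parcs G" "(u, w) \<in> parcs G" "w \<noteq> v"
  shows "branch G u w \<subset> branch G v u"
proof -
  have v: "v \<notin> branch G u w"
    using branch_neighbour_unique[OF assms(2) _ arc_sym[OF assms(1)]] assms(3) by auto
  have "z \<in> branch G v u" if "z \<in> branch G u w" for z
    using that
  proof (induction rule: branch_induct)
    case base
    show ?case using branch_step[OF branch_refl assms(2,3)] arc_irrefl[OF assms(1)] by auto
  next
    case (step y z)
    then have "z \<in> branch G u w"
      using branch_step arc_irrefl[OF assms(2)] by metis
    then have "z \<noteq> v" using v by auto
    then show ?case using branch_step[OF step(4,2)] arc_irrefl[OF assms(1)] by auto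
  qed
  then have "branch G u w \<subseteq> branch G v u" by blast
  then show ?thesis
    using branch_refl[of u G v] not_in_own_branch[OF assms(2)] by auto
qed

text \<open>A walk avoiding \<open>v\<close> is at \<open>u\<close> or inside a branch beyond
  \<open>u\<close>, and it can leave such a branch only through \<open>u\<close>.\<close>

lemma branch_decomp:
  assumes "(v, u) \<in> parcs G"
  shows "branch G v u = insert u (\<Union>w \<in> open_neighbourhood G u - {v}. branch G u w)"
proof
  show "branch G v u \<subseteq> insert u (\<Union>w \<in> open_neighbourhood G u - {v}. branch G u w)"
  proof
    fix z assume "z \<in> branch G v u"
    then show "z \<in> insert u (\<Union>w \<in> open_neighbourhood G u - {v}. branch G u w)"
    proof (induction rule: branch_induct)
      case (step y z)
      show ?case
      proof (cases "y = u")
        case True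
        then show ?thesis using step(2,3) branch_refl[of z G u]
          by (auto simp: open_neighbourhood_def)
      next
        case False
        then obtain w where w: "(u, w) \<in> parcs G" "w \<noteq> v" "y \<in> branch G u w"
          using step(4) by (auto simp: open_neighbourhood_def)
        then have "z = u \<or> z \<in> branch G u w"
          using branch_step[OF w(3) step(2)] arc_irrefl[OF w(1)] by auto
        then show ?thesis using w by (auto simp: open_neighbourhood_def)
      qed
    qed simp
  qed
next
  show "insert u (\<Union>w \<in> open_neighbourhood G u - {v}. branch G u w) \<subseteq> branch G v u"
    using sub_branch[OF assms] branch_refl[of u G v]
    unfolding open_neighbourhood_def by blast
qed

text \<open>Walks can be reversed, so a common vertex would link \<open>u\<close> to
  \<open>w\<close> while avoiding \<open>v\<close>, against
  \<open>branch_neighbour_unique\<close>.\<close>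

lemma branches_disjoint:
  assumes "(v, u) \<in> parcs G" "(v, w) \<in> parcs G" "u \<noteq> w"
  shows "branch G v u \<inter> branch G v w = {}"
proof (rule ccontr)
  assume "branch G v u \<inter> branch G v w \<noteq> {}"
  then obtain z where z: "z \<in> branch G v u" "z \<in> branch G v w" by blast
  have "w \<in> branch G v z" using branch_sym[OF z(2)] arc_irrefl[OF assms(2)] by auto
  then have "w \<in> branch G v u" using z(1) by (auto simp: branch_def)
  then show False using branch_neighbour_unique assms by metis
qed

text \<open>Connectedness enters here: follow a walk from \<open>v\<close> to \<open>x\<close>.
  After its last visit to \<open>v\<close> it stays in the branch it enters.\<close>

lemma in_some_branch:
  assumes "v \<in> pverts G" "x \<in> pverts G" "x \<noteq> v"
  obtains u where "(v, u) \<in> parcs G" "x \<in> branch G v u"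
proof -
  have "strongly_connected (with_proj G)"
    using tree symmetric_connected_imp_strongly_connected[OF pair_sym_arcs]
    unfolding undirected_tree_def by blast
  then have "v \<rightarrow>\<^sup>*\<^bsub>with_proj G\<^esub> x" using assms(1,2) by (auto simp: strongly_connected_def)
  then have "(v, x) \<in> (parcs G)\<^sup>*" using reachable_rtranclI by fastforce
  then have "x = v \<or> (\<exists>u. (v, u) \<in> parcs G \<and> x \<in> branch G v u)"
  proof (induction rule: rtrancl_induct)
    case (step y z)
    then show ?case using branch_refl branch_step arc_irrefl by metis
  qed simp
  then show ?thesis using that assms(3) by blast
qed

text \<open>Walk away from \<open>v\<close>: the branches ahead shrink strictly, so the descent ends
  at a vertex with no neighbour except the one it was entered from.\<close>

lemma branch_contains_leaf:
  assumes "(v, u) \<in> parcs G"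
  shows "\<exists>x. x \<in> leaves G \<inter> branch G v u"
  using assms
proof (induction "card (branch G v u)" arbitrary: v u rule: less_induct)
  case less
  show ?case
  proof (cases "open_neighbourhood G u = {v}")
    case True
    then show ?thesis using less.prems branch_refl in_arcsD2 by (fastforce simp: leaves_def)
  next
    case False
    then obtain w where w: "(u, w) \<in> parcs G" "w \<noteq> v"
      using arc_sym[OF less.prems] by (auto simp: open_neighbourhood_def)
    have s: "branch G u w \<subset> branch G v u" using sub_branch[OF less.prems w] .
    then have "card (branch G u w) < card (branch G v u)"
      using finite_branch[OF less.prems] psubset_card_mono by blast
    from less.hyps[OF this w(1)] s show ?thesis by blast
  qed
qed

section \<open>The tree rooted at a vertex: parents and depth\<close>

text \<open>The next vertex on the path from \<open>v\<close> to the root \<open>x\<close>. Fixing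
  the root lets iterated parents come to rest at \<open>x\<close>.\<close>

definition parent :: "'a \<Rightarrow> 'a \<Rightarrow> 'a" where
  "parent x v = (if v = x then x else THE u. (v, u) \<in> parcs G \<and> x \<in> branch G v u)"

lemma parent_root [simp]: "parent x x = x"
  by (simp add: parent_def)

lemma parent_eqI:
  assumes "(v, u) \<in> parcs G" "x \<in> branch G v u"
  shows "parent x v = u"
proof -
  have "w = u" if "(v, w) \<in> parcs G" "x \<in> branch G v w" for w
    using branches_disjoint[OF assms(1) that(1)] assms(2) that(2) by blast
  then have "(THE u. (v, u) \<in> parcs G \<and> x \<in> branch G v u) = u"
    using assms by blast
  then show ?thesis
    using not_in_own_branch[OF assms(1)] assms(2) by (auto simp: parent_def)
qed

lemma parent_props:
  assumes "v \<in> pverts G" "x \<in> pverts G" "v \<noteq> x"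
  shows "(v, parent x v) \<in> parcs G" "x \<in> branch G v (parent x v)"
proof -
  obtain u where u: "(v, u) \<in> parcs G" "x \<in> branch G v u"
    using in_some_branch[OF assms(1,2)] assms(3) by metis
  with parent_eqI[OF u] show "(v, parent x v) \<in> parcs G" "x \<in> branch G v (parent x v)"
    by auto
qed

lemma parent_in_verts:
  assumes "v \<in> pverts G" "x \<in> pverts G"
  shows "parent x v \<in> pverts G"
  using assms parent_props(1)[OF assms] in_arcsD2 by (cases "v = x") auto

lemma parent_pow_in_verts:
  assumes "v \<in> pverts G" "x \<in> pverts G"
  shows "(parent x ^^ n) v \<in> pverts G"
  by (induction n) (auto intro: assms parent_in_verts)

lemma token_move_parent:
  assumes "v \<in> pverts G" "x \<in> pverts G"
  shows "token_move G v (parent x v)" "token_move G (parent x v) v"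
  using parent_props(1)[OF assms] arc_sym
  by (cases "v = x"; auto simp: token_move_def open_neighbourhood_def)+

text \<open>If the branch at \<open>v\<close> containing \<open>x\<close> is not the one of
  \<open>u\<close>, then, seen from \<open>u\<close>, it lies inside the branch of
  \<open>v\<close>.\<close>

lemma parent_adjacent:
  assumes "(v, u) \<in> parcs G" "x \<in> pverts G"
  shows "parent x v = u \<or> parent x u = v"
proof (cases "x = v")
  case True
  then show ?thesis using parent_eqI[OF arc_sym[OF assms(1)]] branch_refl by metis
next
  case False
  have p: "(v, parent x v) \<in> parcs G" "x \<in> branch G v (parent x v)"
    using parent_props[OF in_arcsD1[OF assms(1)] assms(2)] False by auto
  show ?thesis
  proof (cases "parent x v = u")
    case False
    then have "x \<in> branch G u v"
      using sub_branch[OF arc_sym[OF assms(1)] p(1)] p(2) by blast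
    then show ?thesis using parent_eqI[OF arc_sym[OF assms(1)]] by simp
  qed simp
qed

text \<open>Not the distance to \<open>x\<close>, but also strictly decreasing along \<open>parent x\<close>.\<close>

definition depth :: "'a \<Rightarrow> 'a \<Rightarrow> nat" where
  "depth x v = (if v = x then 0 else card (branch G v (parent x v)))"

lemma depth_pos:
  assumes "v \<in> pverts G" "x \<in> pverts G" "v \<noteq> x"
  shows "0 < depth x v"
  using parent_props[OF assms] finite_branch assms(3) by (auto simp: depth_def card_gt_0_iff)

lemma depth_le:
  assumes "v \<in> pverts G" "x \<in> pverts G"
  shows "depth x v \<le> card (pverts G)"
  using parent_props(1)[OF assms] branch_subset_verts card_mono[OF pair_finite_verts]
  by (auto simp: depth_def)

text \<open>If \<open>parent x v\<close> is not yet the root, then the root lies in a branch beyond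
  it, which is a strict sub-branch of the one measured at \<open>v\<close>.\<close>

lemma depth_parent:
  assumes "v \<in> pverts G" "x \<in> pverts G" "v \<noteq> x"
  shows "depth x (parent x v) < depth x v"
proof (cases "parent x v = x")
  case True
  then show ?thesis using depth_pos[OF assms] by (simp add: depth_def)
next
  case False
  let ?u = "parent x v"
  note p = parent_props[OF assms]
  obtain w where w: "(?u, w) \<in> parcs G" "w \<noteq> v" "x \<in> branch G ?u w"
    using branch_decomp[OF p(1)] p(2) False by (auto simp: open_neighbourhood_def)
  have "parent x ?u = w" using parent_eqI[OF w(1,3)] .
  moreover have "card (branch G ?u w) < card (branch G v ?u)"
    using sub_branch[OF p(1) w(1,2)] finite_branch[OF p(1)] psubset_card_mono by blast
  ultimately show ?thesis using False assms(3) by (simp add: depth_def)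
qed

text \<open>The depth drops with every step until the root is reached, and further steps stay
  there.\<close>

lemma parent_pow_eq_root:
  assumes "v \<in> pverts G" "x \<in> pverts G" "depth x v \<le> n"
  shows "(parent x ^^ n) v = x"
  using assms(1,3)
proof (induction n arbitrary: v)
  case 0
  then show ?case using depth_pos[OF _ assms(2)] by fastforce
next
  case (Suc n)
  have "depth x (parent x v) \<le> n"
    using depth_parent[OF Suc.prems(1) assms(2)] Suc.prems(2)
    by (cases "v = x") (auto simp: depth_def)
  then show ?case
    using Suc.IH[OF parent_in_verts[OF Suc.prems(1) assms(2)]]
    by (simp add: funpow_swap1)
qed

section \<open>Chasing the president from a fixed root\<close>

text \<open>The president moves to a child of his vertex. The condition \<open>w \<noteq> v\<close>
  keeps waiting at the root, its own parent, from counting as a retreat.\<close>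

definition retreats :: "'a \<Rightarrow> 'a \<Rightarrow> 'a \<Rightarrow> bool" where
  "retreats x v w \<longleftrightarrow> w \<noteq> v \<and> parent x w = v"

text \<open>After the president's \<open>n\<close>-th turn the bodyguard of \<open>x\<close> moves to the \<open>gap x p n\<close>-th iterated
  parent of \<open>p n\<close>.  The initial value is large enough for that vertex to be \<open>x\<close> itself.\<close>

fun gap :: "'a \<Rightarrow> (nat \<Rightarrow> 'a) \<Rightarrow> nat \<Rightarrow> nat" where
  "gap x p 0 = card (pverts G)"
| "gap x p (Suc n) =
     (if retreats x (p n) (p (Suc n)) then gap x p n else max 1 (gap x p n - 1))"

lemma gap_cong:
  assumes "\<And>i. i \<le> n \<Longrightarrow> p i = q i"
  shows "gap x p n = gap x q n"
  using assms by (induction n) auto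

lemma gap_pos: "x \<in> pverts G \<Longrightarrow> 1 \<le> gap x p n"
  using pair_finite_verts by (induction n) (auto simp: Suc_le_eq card_gt_0_iff)

lemma play_in_verts:
  assumes "president_play G p"
  shows "p n \<in> pverts G"
proof (induction n)
  case (Suc n)
  have "token_move G (p n) (p (Suc n))" using assms by (simp add: president_play_def)
  then show ?case using Suc in_arcsD2 by (auto simp: token_move_def open_neighbourhood_def)
qed (use assms in \<open>simp add: president_play_def\<close>)

text \<open>By \<open>parent_adjacent\<close> the president moves to a child, stays, or moves to the
  parent. The bodyguard then follows him by one step, closes in by one step, or waits, respectively.
  Only a gap of 1 alters the last two responses, because the gap never drops to 0.\<close>

lemma token_move_chase:
  assumes "president_play G p" "x \<in> pverts G"
  shows "token_move G ((parent x ^^ gap x p n) (p n)) ((parent x ^^ gap x p (Suc n)) (p (Suc n)))"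
proof -
  let ?a = "p n" and ?b = "p (Suc n)" and ?g = "gap x p n"
  have ab: "token_move G ?a ?b" using assms(1) by (simp add: president_play_def)
  have V: "?a \<in> pverts G" "?b \<in> pverts G" using play_in_verts[OF assms(1)] by auto
  obtain h where h: "?g = Suc h" using gap_pos[OF assms(2), of p n] by (cases ?g) auto
  have down: "token_move G ((parent x ^^ Suc m) v) ((parent x ^^ m) v)" if "v \<in> pverts G" for m v
    using token_move_parent(2)[OF parent_pow_in_verts[OF that assms(2)] assms(2)] by simp
  consider "retreats x ?a ?b" | "\<not> retreats x ?a ?b" "?b = ?a"
    | "\<not> retreats x ?a ?b" "parent x ?a = ?b"
    using ab parent_adjacent[OF _ assms(2), of ?a ?b]
    by (auto simp: token_move_def open_neighbourhood_def retreats_def)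
  then show ?thesis
  proof cases
    case 1
    then have "(parent x ^^ ?g) ?a = (parent x ^^ Suc ?g) ?b"
      by (simp add: retreats_def funpow_swap1)
    then show ?thesis using 1 down[OF V(2)] by simp
  next
    case 2
    show ?thesis
    proof (cases h)
      case 0
      then show ?thesis using 2 h by (simp add: token_move_def)
    next
      case (Suc h')
      then show ?thesis using 2 h down[OF V(1), of h] by simp
    qed
  next
    case 3
    have e: "(parent x ^^ ?g) ?a = (parent x ^^ h) ?b" using h 3 by (simp add: funpow_swap1)
    show ?thesis
    proof (cases h)
      \<comment> \<open>At gap 1 the bodyguard stands on the very vertex \<open>?b\<close> that the
        president enters, so it backs off to \<open>parent x ?b\<close>.\<close>
      case 0
      then show ?thesis using 3 h token_move_parent(1)[OF V(2) assms(2)] by simp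
    next
      case (Suc h')
      then have "gap x p (Suc n) = h" using 3 h by simp
      then show ?thesis using e by (simp add: token_move_def)
    qed
  qed
qed

text \<open>The measure \<open>M\<close> is lexicographic: first the gap, then the depth still
  available to the president. The second part is at most \<open>?C\<close>, so the factor
  \<open>Suc ?C\<close> lets the gap dominate. Once the gap is 1 it stays 1.\<close>

lemma gap_eventually_1:
  assumes "president_play G p" "x \<in> pverts G"
  shows "\<forall>\<^sub>F n in sequentially. gap x p n = 1"
proof -
  let ?C = "card (pverts G)"
  \<comment> \<open>While the gap exceeds 1, it shrinks unless the president gets deeper below \<open>x\<close>.\<close>
  define M where "M n = gap x p n * Suc ?C + (?C - depth x (p n))" for n
  note V = play_in_verts[OF assms(1)]
  have dec: "M (Suc n) < M n" if g: "gap x p n \<noteq> 1" for n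
  proof (cases "retreats x (p n) (p (Suc n))")
    case True
    then have "p (Suc n) \<noteq> x" "parent x (p (Suc n)) = p n" by (auto simp: retreats_def)
    then have "depth x (p n) < depth x (p (Suc n))"
      using depth_parent[OF V assms(2), of "Suc n"] by simp
    moreover have "depth x (p (Suc n)) \<le> ?C" using depth_le[OF V assms(2)] .
    ultimately show ?thesis using True by (simp add: M_def)
  next
    case False
    obtain h where h: "gap x p n = Suc h" "1 \<le> h"
      using g gap_pos[OF assms(2), of p n] by (cases "gap x p n") auto
    then have "gap x p (Suc n) = h" using False by simp
    then have "M (Suc n) \<le> h * Suc ?C + ?C" by (simp add: M_def)
    also have "\<dots> < Suc h * Suc ?C" by simp
    also have "\<dots> \<le> M n" using h(1) by (simp add: M_def)
    finally show ?thesis .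
  qed
  have "\<exists>N. gap x p N = 1"
  proof (rule ccontr)
    assume "\<nexists>N. gap x p N = 1"
    then have d: "M (Suc n) < M n" for n using dec by blast
    have "M n + n \<le> M 0" for n
    proof (induction n)
      case (Suc n)
      then show ?case using d[of n] by linarith
    qed simp
    from this[of "Suc (M 0)"] show False by simp
  qed
  then obtain N where N: "gap x p N = 1" by blast
  have "gap x p n = 1" if "N \<le> n" for n
    using that by (induction n rule: dec_induct) (use N in auto)
  then show ?thesis unfolding eventually_sequentially by blast
qed

section \<open>Upper bound: one bodyguard per leaf wins\<close>

lemma bodyguards_win_card_leaves: "bodyguards_win G (card (leaves G))"
proof -
  let ?k = "card (leaves G)"
  have leaves: "leaves G \<subseteq> pverts G" by (auto simp: leaves_def)
  then obtain f :: "nat \<Rightarrow> 'a" where "bij_betw f {0..<?k} (leaves G)"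
    using ex_bij_betw_nat_finite finite_subset[OF _ pair_finite_verts] by blast
  then have f: "f ` {..<?k} = leaves G" by (simp add: bij_betw_def lessThan_atLeast0)
  then have fV: "f i \<in> pverts G" if "i < ?k" for i using that leaves by blast
  \<comment> \<open>The history \<open>ps\<close> is read as a play through \<open>(!)\<close>. Its
    last index is \<open>length ps - 1\<close>, and \<open>gap\<close> looks at no later
    entry.\<close>
  define S :: "'a bodyguard_strategy" where
    "S ps i = (if ps = [] then f i
       else (parent (f i) ^^ gap (f i) ((!) ps) (length ps - 1)) (last ps))" for ps i
  have S: "bodyguards_at S p (Suc n) i = (parent (f i) ^^ gap (f i) p n) (p n)" for p n i
  proof -
    have "gap (f i) ((!) (map p [0..<Suc n])) n = gap (f i) p n"
      by (rule gap_cong) (simp add: nth_append del: upt_Suc)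
    then show ?thesis by (simp add: bodyguards_at_def S_def)
  qed
  have "legal_strategy G ?k S"
    unfolding legal_strategy_def
  proof (intro conjI allI impI)
    fix i assume "i < ?k"
    then show "S [] i \<in> pverts G" using fV by (simp add: S_def)
  next
    fix p n i assume p: "president_play G p" and i: "i < ?k"
    show "token_move G (bodyguards_at S p n i) (bodyguards_at S p (Suc n) i)"
    proof (cases n)
      case 0
      \<comment> \<open>The initial gap is at least every depth, so the first response is still
        \<open>f i\<close>, whichever vertex the president has chosen.\<close>
      have "(parent (f i) ^^ card (pverts G)) (p 0) = f i"
        using parent_pow_eq_root depth_le play_in_verts[OF p] fV[OF i] by blast
      then have "bodyguards_at S p (Suc 0) i = f i" using S by simp
      moreover have "bodyguards_at S p 0 i = f i" by (simp add: bodyguards_at_def S_def)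
      ultimately show ?thesis using 0 by (simp add: token_move_def)
    next
      case (Suc m)
      then show ?thesis using S token_move_chase[OF p fV[OF i]] by simp
    qed
  qed
  moreover have "\<exists>N. \<forall>n\<ge>N. surrounded G ?k (bodyguards_at S p (Suc n)) (p n)"
    if p: "president_play G p" for p
  proof -
    have "\<forall>\<^sub>F n in sequentially. \<forall>i\<in>{..<?k}. gap (f i) p n = 1"
      using gap_eventually_1[OF p] fV by (intro eventually_ball_finite) auto
    then obtain N where N: "\<And>n i. \<lbrakk>N \<le> n; i < ?k\<rbrakk> \<Longrightarrow> gap (f i) p n = 1"
      by (auto simp: eventually_sequentially)
    have "surrounded G ?k (bodyguards_at S p (Suc n)) (p n)" if "N \<le> n" for n
      unfolding surrounded_def
    proof
      fix u assume "u \<in> open_neighbourhood G (p n)"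
      then have u: "(p n, u) \<in> parcs G" by (simp add: open_neighbourhood_def)
      \<comment> \<open>The bodyguard of a leaf beyond \<open>u\<close> has gap 1, so it stands on
        the president's neighbour towards that leaf, which is \<open>u\<close>.\<close>
      then obtain x where x: "x \<in> leaves G" "x \<in> branch G (p n) u"
        using branch_contains_leaf by blast
      then obtain i where i: "i < ?k" "f i = x" using f by (metis imageE lessThan_iff)
      then have "bodyguards_at S p (Suc n) i = u"
        using S N[OF \<open>N \<le> n\<close> i(1)] parent_eqI[OF u x(2)] by simp
      then show "u \<in> bodyguards_at S p (Suc n) ` {..<?k}" using i(1) by blast
    qed
    then show ?thesis by blast
  qed
  ultimately show ?thesis unfolding bodyguards_win_def by blast
qed

section \<open>Lower bound: histories that leave the president surrounded, and counting in
  branches\<close>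

text \<open>Branches at \<open>v\<close> are disjoint, so no bodyguard is counted twice and the
  bounds for single branches add up.\<close>

lemma card_leaves_Union_branches_le:
  fixes g :: "nat \<Rightarrow> 'a"
  assumes W: "W \<subseteq> open_neighbourhood G v"
    and le: "\<And>w. w \<in> W \<Longrightarrow>
      card (leaves G \<inter> branch G v w) \<le> card {i. i < k \<and> g i \<in> branch G v w}"
  shows "card (leaves G \<inter> (\<Union>w\<in>W. branch G v w)) \<le> card {i. i < k \<and> g i \<in> (\<Union>w\<in>W. branch G v w)}"
proof -
  have fin: "finite W" using finite_subset[OF W finite_neighbourhood] .
  have arcs: "(v, w) \<in> parcs G" if "w \<in> W" for w
    using that W by (auto simp: open_neighbourhood_def)
  have "card (leaves G \<inter> (\<Union>w\<in>W. branch G v w)) = card (\<Union>w\<in>W. leaves G \<inter> branch G v w)"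
    by (rule arg_cong[where f = card]) blast
  also have "\<dots> \<le> (\<Sum>w\<in>W. card (leaves G \<inter> branch G v w))"
    by (rule card_UN_le[OF fin])
  also have "\<dots> \<le> (\<Sum>w\<in>W. card {i. i < k \<and> g i \<in> branch G v w})"
    by (rule sum_mono) (rule le)
  also have "\<dots> = card (\<Union>w\<in>W. {i. i < k \<and> g i \<in> branch G v w})"
  proof (rule card_UN_disjoint[symmetric, OF fin])
    show "\<forall>w\<in>W. \<forall>w'\<in>W. w \<noteq> w' \<longrightarrow>
        {i. i < k \<and> g i \<in> branch G v w} \<inter> {i. i < k \<and> g i \<in> branch G v w'} = {}"
    proof (intro ballI impI)
      fix w w' assume "w \<in> W" "w' \<in> W" "w \<noteq> w'"
      then have "branch G v w \<inter> branch G v w' = {}" by (intro branches_disjoint arcs)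
      then show "{i. i < k \<and> g i \<in> branch G v w} \<inter> {i. i < k \<and> g i \<in> branch G v w'} = {}"
        by auto
    qed
  qed auto
  also have "(\<Union>w\<in>W. {i. i < k \<and> g i \<in> branch G v w}) = {i. i < k \<and> g i \<in> (\<Union>w\<in>W. branch G v w)}"
    by auto
  finally show ?thesis .
qed

text \<open>The play \<open>p\<close> serves to carry the history \<open>p 0, ..., p n\<close>,
  after which the strategy keeps the president surrounded under every continuation.\<close>

definition secured :: "'a bodyguard_strategy \<Rightarrow> nat \<Rightarrow> (nat \<Rightarrow> 'a) \<Rightarrow> nat \<Rightarrow> bool" where
  "secured S k p n \<longleftrightarrow> president_play G p \<and>
     (\<forall>q. president_play G q \<longrightarrow> (\<forall>i\<le>n. q i = p i) \<longrightarrow>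
        (\<forall>m\<ge>n. surrounded G k (bodyguards_at S q (Suc m)) (q m)))"

lemma secured_surrounded:
  assumes "secured S k p n"
  shows "surrounded G k (bodyguards_at S p (Suc n)) (p n)"
  using assms unfolding secured_def by blast

text \<open>A play agreeing with \<open>q\<close> up to \<open>Suc n\<close> agrees with
  \<open>p\<close> up to \<open>n\<close>, so security passes to every legal continuation.\<close>

lemma secured_move:
  assumes "secured S k p n" "token_move G (p n) w"
  obtains q where "secured S k q (Suc n)" "q (Suc n) = w" "\<And>i. i \<le> n \<Longrightarrow> q i = p i"
proof -
  \<comment> \<open>Resting on \<open>w\<close> forever completes the extended history to a full
    play.\<close>
  define q where "q i = (if i \<le> n then p i else w)" for i
  have "president_play G q"
    unfolding president_play_def
  proof (intro conjI allI)
    show "q 0 \<in> pverts G" using assms(1) by (simp add: q_def secured_def president_play_def)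
    fix i
    show "token_move G (q i) (q (Suc i))"
    proof (cases i n rule: linorder_cases)
      case less
      then show ?thesis using assms(1) by (simp add: q_def secured_def president_play_def)
    next
      case equal
      then show ?thesis using assms(2) by (simp add: q_def)
    next
      case greater
      then show ?thesis by (simp add: q_def token_move_def)
    qed
  qed
  moreover have "\<forall>i\<le>n. r i = p i" if "\<forall>i\<le>Suc n. r i = q i" for r
    using that by (simp add: q_def)
  ultimately have "secured S k q (Suc n)"
    using assms(1) unfolding secured_def by (meson Suc_leD)
  then show ?thesis using that[of q] by (simp add: q_def)
qed

lemma bodyguards_at_cong:
  assumes "\<forall>i\<le>n. p i = q i"
  shows "bodyguards_at S p (Suc n) = bodyguards_at S q (Suc n)"
proof -
  have "map p [0..<Suc n] = map q [0..<Suc n]" using assms by (intro map_cong) auto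
  then show ?thesis by (simp only: bodyguards_at_def)
qed

text \<open>Otherwise the president could break out again and again, and the limit of the resulting
  plays would be one in which he is left unsurrounded infinitely often.\<close>

lemma secured_exists:
  assumes "pverts G \<noteq> {}"
    and win: "\<And>p. president_play G p \<Longrightarrow>
      \<exists>N. \<forall>n\<ge>N. surrounded G k (bodyguards_at S p (Suc n)) (p n)"
  obtains p n where "secured S k p n"
proof (rule ccontr)
  let ?surr = "\<lambda>p n. surrounded G k (bodyguards_at S p (Suc n)) (p n)"
  assume "\<not> thesis"
  then have "\<not> secured S k p n" for p n using that by blast
  then have escape: "\<exists>q m. president_play G q \<and> (\<forall>i\<le>n. q i = p i) \<and> n \<le> m \<and> \<not> ?surr q m"
    if "president_play G p" for p n
    using that unfolding secured_def by blast
  obtain v where v: "v \<in> pverts G" using assms(1) by blast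
  have "\<exists>f. \<forall>j. (case f j of (p, n) \<Rightarrow> president_play G p) \<and>
    (case (f j, f (Suc j)) of ((p, n), (q, m)) \<Rightarrow> (\<forall>i\<le>n. q i = p i) \<and> n < m \<and> \<not> ?surr q m)"
  proof (rule dependent_nat_choice)
    have "president_play G (\<lambda>_. v)" using v by (simp add: president_play_def token_move_def)
    then show "\<exists>x. case x of (p, n) \<Rightarrow> president_play G p" by auto
  next
    fix x :: "(nat \<Rightarrow> 'a) \<times> nat" and j :: nat
    assume x: "case x of (p, n) \<Rightarrow> president_play G p"
    obtain p n where pn: "x = (p, n)" by (cases x)
    then have "president_play G p" using x by simp
    \<comment> \<open>Agreement up to \<open>Suc n\<close> makes the new unsurrounded moment
      strictly later than \<open>n\<close>.\<close>
    from escape[OF this, of "Suc n"] obtain q m where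
      "president_play G q" "\<forall>i\<le>Suc n. q i = p i" "Suc n \<le> m" "\<not> ?surr q m" by blast
    then show "\<exists>y. (case y of (p, n) \<Rightarrow> president_play G p) \<and>
        (case (x, y) of ((p, n), (q, m)) \<Rightarrow> (\<forall>i\<le>n. q i = p i) \<and> n < m \<and> \<not> ?surr q m)"
      using pn by (intro exI[of _ "(q, m)"]) auto
  qed
  then obtain f where f: "\<And>j. (case f j of (p, n) \<Rightarrow> president_play G p) \<and>
    (case (f j, f (Suc j)) of ((p, n), (q, m)) \<Rightarrow> (\<forall>i\<le>n. q i = p i) \<and> n < m \<and> \<not> ?surr q m)"
    by blast
  define P where "P j = fst (f j)" for j
  define t where "t j = snd (f j)" for j
  have play: "president_play G (P j)" and agree: "\<forall>i\<le>t j. P (Suc j) i = P j i"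
    and t: "t j < t (Suc j)" and esc: "\<not> ?surr (P (Suc j)) (t (Suc j))" for j
    using f[of j] by (auto simp: P_def t_def split: prod.splits)
  have mono: "strict_mono t" using t by (simp add: strict_mono_Suc_iff)
  have agree': "P j' i = P j i" if "j \<le> j'" "i \<le> t j" for j j' i
    using that(1)
  proof (induction j' rule: dec_induct)
    case (step j')
    have "t j \<le> t j'" using step(1) mono by (simp add: strict_mono_less_eq)
    then show ?case using step agree[of j'] that(2) by simp
  qed simp
  \<comment> \<open>The limit is a diagonal: since \<open>t\<close> is strictly increasing,
    \<open>i \<le> t i\<close>, so entry \<open>i\<close> no longer changes from \<open>P i\<close>
    on.\<close>
  define q where "q i = P i i" for i
  have q: "q i = P j i" if "i \<le> t j" for i j
  proof (cases "i \<le> j")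
    case True
    then show ?thesis using agree'[of i j i] strict_mono_imp_increasing[OF mono, of i] by (simp add: q_def)
  next
    case False
    then show ?thesis using agree'[of j i i] that by (simp add: q_def)
  qed
  have "president_play G q"
    unfolding president_play_def
  proof (intro conjI allI)
    show "q 0 \<in> pverts G" using play by (simp add: q_def president_play_def)
    fix i
    have "Suc i \<le> t (Suc i)" using strict_mono_imp_increasing[OF mono] .
    then have "q i = P (Suc i) i" "q (Suc i) = P (Suc i) (Suc i)" using q by auto
    then show "token_move G (q i) (q (Suc i))" using play by (simp add: president_play_def)
  qed
  then obtain N where N: "\<And>n. N \<le> n \<Longrightarrow> ?surr q n" using win by blast
  have "N \<le> t (Suc N)" using strict_mono_imp_increasing[OF mono, of "Suc N"] by simp
  then have "?surr q (t (Suc N))" by (rule N)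
  \<comment> \<open>Up to this moment \<open>q\<close> has the history of \<open>P (Suc N)\<close>,
    and the strategy sees nothing else, so the president escapes in \<open>q\<close> as
    well.\<close>
  moreover have "\<forall>i\<le>t (Suc N). q i = P (Suc N) i" using q by blast
  ultimately show False
    using esc[of N] bodyguards_at_cong[of "t (Suc N)" q "P (Suc N)" S] by simp
qed

text \<open>If the branch is just \<open>u\<close>, surrounding puts a bodyguard there. Otherwise
  let the president step to \<open>u\<close> and apply induction to the branches ahead: bodyguards
  inside them after the response were already in the branch of \<open>u\<close> one turn
  earlier.\<close>

lemma card_leaves_branch_le:
  assumes "legal_strategy G k S" "secured S k p n" "(p n, u) \<in> parcs G"
  shows "card (leaves G \<inter> branch G (p n) u)
    \<le> card {i. i < k \<and> bodyguards_at S p (Suc n) i \<in> branch G (p n) u}"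
  using assms(2,3)
proof (induction "card (branch G (p n) u)" arbitrary: p n u rule: less_induct)
  case less
  let ?v = "p n" and ?g = "bodyguards_at S p (Suc n)"
  let ?W = "open_neighbourhood G u - {?v}"
  note arc = less.prems(2)
  show ?case
  proof (cases "?W = {}")
    case True
    have "branch G ?v u = {u}" unfolding branch_decomp[OF arc] True by simp
    moreover obtain i where "i < k" "?g i = u"
      using secured_surrounded[OF less.prems(1)] arc
      by (auto simp: surrounded_def open_neighbourhood_def)
    ultimately have "0 < card {i. i < k \<and> ?g i \<in> branch G ?v u}"
      by (auto simp: card_gt_0_iff)
    moreover have "card (leaves G \<inter> branch G ?v u) \<le> card {u}"
      using \<open>branch G ?v u = {u}\<close> by (intro card_mono) auto
    ultimately show ?thesis by simp
  next
    case False
    have "token_move G ?v u" using arc by (simp add: token_move_def open_neighbourhood_def)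
    then obtain q where q: "secured S k q (Suc n)" "q (Suc n) = u" "\<And>i. i \<le> n \<Longrightarrow> q i = p i"
      using secured_move[OF less.prems(1)] by metis
    let ?h = "bodyguards_at S q (Suc (Suc n))"
    \<comment> \<open>Turn \<open>Suc n\<close> answers \<open>p n\<close>, before the step to
      \<open>u\<close>, so both plays give the same positions.\<close>
    have g: "?g = bodyguards_at S q (Suc n)" using q(3) by (intro bodyguards_at_cong) auto
    have move: "token_move G (?g i) (?h i)" if "i < k" for i
      using assms(1) q(1) that unfolding g legal_strategy_def secured_def by blast
    have "u \<notin> leaves G"
      using leaf_neighbourhood[OF _ arc_sym[OF arc]] False by blast
    then have "leaves G \<inter> branch G ?v u = leaves G \<inter> (\<Union>w\<in>?W. branch G u w)"
      unfolding branch_decomp[OF arc] by blast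
    then have "card (leaves G \<inter> branch G ?v u) = card (leaves G \<inter> (\<Union>w\<in>?W. branch G u w))"
      by simp
    also have "\<dots> \<le> card {i. i < k \<and> ?h i \<in> (\<Union>w\<in>?W. branch G u w)}"
    proof (rule card_leaves_Union_branches_le)
      fix w assume "w \<in> ?W"
      then have w: "(u, w) \<in> parcs G" "w \<noteq> ?v" by (auto simp: open_neighbourhood_def)
      have "card (branch G u w) < card (branch G ?v u)"
        using sub_branch[OF arc w] finite_branch[OF arc] psubset_card_mono by blast
      then show "card (leaves G \<inter> branch G u w) \<le> card {i. i < k \<and> ?h i \<in> branch G u w}"
        using less.hyps[of q "Suc n" w] q(1,2) w(1) by simp
    qed auto
    also have "\<dots> \<le> card {i. i < k \<and> ?g i \<in> branch G ?v u}"
    proof (rule card_mono)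
      show "{i. i < k \<and> ?h i \<in> (\<Union>w\<in>?W. branch G u w)} \<subseteq> {i. i < k \<and> ?g i \<in> branch G ?v u}"
      proof
        fix i assume "i \<in> {i. i < k \<and> ?h i \<in> (\<Union>w\<in>?W. branch G u w)}"
        then obtain w where i: "i < k" and w: "(u, w) \<in> parcs G" "w \<in> ?W"
          and h: "?h i \<in> branch G u w"
          by (auto simp: open_neighbourhood_def)
        \<comment> \<open>The last bodyguard move is read backwards: one step from inside a branch
          beyond \<open>u\<close> either stays inside or lands on \<open>u\<close>.\<close>
        have "?g i = ?h i \<or> (?h i, ?g i) \<in> parcs G"
          using move[OF i] arc_sym by (auto simp: token_move_def open_neighbourhood_def)
        then have "?g i = u \<or> ?g i \<in> branch G u w"
          using h branch_step[OF h] arc_irrefl[OF w(1)] by metis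
        then have "?g i \<in> branch G ?v u" using w(2) unfolding branch_decomp[OF arc] by blast
        with i show "i \<in> {i. i < k \<and> ?g i \<in> branch G ?v u}" by blast
      qed
    qed simp
    finally show ?thesis .
  qed
qed

text \<open>Two adjacent leaves have no further neighbours, so by connectedness they would form the
  whole tree, contrary to the three vertices assumed.\<close>

lemma leaf_neighbour_not_leaf:
  assumes "3 \<le> card (pverts G)" "(v, u) \<in> parcs G" "v \<in> leaves G"
  shows "u \<notin> leaves G"
proof
  assume "u \<in> leaves G"
  then have "branch G v u = {u}"
    using leaf_neighbourhood[OF _ arc_sym[OF assms(2)]] unfolding branch_decomp[OF assms(2)] by simp
  moreover have "x \<in> branch G v u" if x: "x \<in> pverts G" "x \<noteq> v" for x
  proof -
    obtain w where w: "(v, w) \<in> parcs G" "x \<in> branch G v w"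
      using in_some_branch[OF in_arcsD1[OF assms(2)] x] .
    then show ?thesis
      using leaf_neighbourhood[OF assms(3,2)] by (auto simp: open_neighbourhood_def)
  qed
  ultimately have "pverts G \<subseteq> {v, u}" by blast
  then have "card (pverts G) \<le> card {v, u}" by (intro card_mono) auto
  also have "\<dots> \<le> 2" by (simp add: card_insert_if)
  finally show False using assms(1) by simp
qed

lemma card_leaves_le:
  assumes "3 \<le> card (pverts G)" "bodyguards_win G k"
  shows "card (leaves G) \<le> k"
proof -
  obtain S where S: "legal_strategy G k S"
    and win: "\<And>p. president_play G p \<Longrightarrow>
      \<exists>N. \<forall>n\<ge>N. surrounded G k (bodyguards_at S p (Suc n)) (p n)"
    using assms(2) unfolding bodyguards_win_def by blast
  have "pverts G \<noteq> {}" using assms(1) by auto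
  then obtain p n where pn: "secured S k p n" using secured_exists win by blast
  \<comment> \<open>The branches at \<open>p n\<close> omit \<open>p n\<close> itself, so the
    president is first moved off a leaf; then they cover all leaves.\<close>
  have "\<exists>p n. secured S k p n \<and> p n \<notin> leaves G"
  proof (cases "p n \<in> leaves G")
    case True
    then obtain u where "open_neighbourhood G (p n) = {u}"
      by (auto simp: leaves_def card_1_singleton_iff)
    then have u: "(p n, u) \<in> parcs G" by (auto simp: open_neighbourhood_def)
    then have "token_move G (p n) u" by (simp add: token_move_def open_neighbourhood_def)
    then obtain q where "secured S k q (Suc n)" "q (Suc n) = u"
      using secured_move[OF pn] by metis
    then show ?thesis using leaf_neighbour_not_leaf[OF assms(1) u True] by blast
  qed (use pn in blast)
  then obtain p n where pn: "secured S k p n" "p n \<notin> leaves G" by blast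
  let ?B = "\<Union>u\<in>open_neighbourhood G (p n). branch G (p n) u"
  have "p n \<in> pverts G" using pn(1) play_in_verts by (simp add: secured_def)
  then have "x \<in> ?B" if "x \<in> leaves G" for x
    using in_some_branch[of "p n" x] pn(2) that
    by (auto simp: leaves_def open_neighbourhood_def)
  then have "leaves G = leaves G \<inter> ?B" by blast
  then have "card (leaves G) = card (leaves G \<inter> ?B)" by simp
  also have "\<dots> \<le> card {i. i < k \<and> bodyguards_at S p (Suc n) i \<in> ?B}"
    using card_leaves_branch_le[OF S pn(1)]
    by (intro card_leaves_Union_branches_le) (auto simp: open_neighbourhood_def)
  also have "\<dots> \<le> card {..<k}" by (intro card_mono) auto
  finally show ?thesis by simp
qed

end

theorem theorem3p3:
  fixes T :: "'a pair_pre_digraph"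
  assumes "undirected_tree T"
    and "3 \<le> card (pverts T)"
  shows "bodyguard_number T = card (leaves T)"
proof -
  interpret pair_graph T using assms(1) by (simp add: undirected_tree_def)
  interpret undirected_tree_graph T by unfold_locales (fact assms(1))
  show ?thesis
    unfolding bodyguard_number_def
    using bodyguards_win_card_leaves card_leaves_le[OF assms(2)] by (rule Least_equality)
qed

end
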